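(* Let $M$ be an EMV-algebra. Then $\mathcal S(M)$ equals the closure, in the weak topology of states on $M$, of the convex hull $\mathrm{Con}(\mathcal{SM}(M))$ (the set of all finite convex combinations of state-morphisms on $M$).
   Context: An EMV-algebra is an algebra $(M;\vee,\wedge,\oplus,0)$ of type $\langle 2,2,2,0\rangle$ such that: (i) $(M;\oplus,0)$ is a commutative monoid with neutral element $0$; (ii) $(M;\vee,\wedge,0)$ is a distributive lattice with bottom element $0$ (with lattice order $\le$); (iii) for each idempotent $a$ (i.e. $a\oplus a=a$; the set of idempotents is $\mathcal I(M)$), the algebra $([0,a];\oplus,\lambda_a,0,a)$ is an MV-algebra, where $[0,a]=\{x\in M:0\le x\le a\}$ and $\lambda_a(x)=\min\{z\in[0,a]: z\oplus x=a\}$; (iv) each $x\in M$ lies below some idempotent. For $x,y\le a\in\mathcal I(M)$, $x\odot y=\lambda_a(\lambda_a(x)\oplus\lambda_a(y))$ (independent of $a$). $x+y$ is defined iff $x\odot y=0$, and then $x+y=x\oplus y$. A state is a map $s:M\to[0,1]$ with $s(x+y)=s(x)+s(y)$ whenever $x+y$ is defined and $s(a)=1$ for some $a\in M$; $\mathcal S(M)$ is the set of states. A state-morphism is a map $s:M\to[0,1]$ preserving $\vee,\wedge,\oplus$ (with $u\oplus v=\min\{u+v,1\}$ on $[0,1]$) and $0$, satisfying $s(\lambda_b(x))=s(b)-s(x)$ for $b\in\mathcal I(M)$, $x\le b$, and attaining the value $1$; $\mathcal{SM}(M)$ is the set of state-morphisms. The weak topology of states is the topology on $\mathcal S(M)$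 induced by the product topology of $[0,1]^M$ (pointwise convergence).
   Formalization: The monoid (M;⊕,0) is taken to be ordered: x≤y implies x⊕z≤y⊕z for the lattice order. Axioms (i)–(iv) as listed do not force this, and without it the claim fails (free one-generated MV-algebra with a total order extending its MV-order). *)

theory Defs
  imports "HOL-Analysis.Analysis"
begin

locale mv_algebra_on =
  fixes A :: "'a set"
    and plus :: "'a \<Rightarrow> 'a \<Rightarrow> 'a"
    and neg :: "'a \<Rightarrow> 'a"
    and zero :: 'a
    and one :: 'a
  assumes plus_closed: "x \<in> A \<Longrightarrow> y \<in> A \<Longrightarrow> plus x y \<in> A"
    and neg_closed: "x \<in> A \<Longrightarrow> neg x \<in> A"
    and zero_closed: "zero \<in> A"
    and one_closed: "one \<in> A"
    and plus_assoc: "x \<in> A \<Longrightarrow> y \<in> A \<Longrightarrow> z \<in> A \<Longrightarrow> plus (plus x y) z = plus x (plus y z)"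
    and plus_comm: "x \<in> A \<Longrightarrow> y \<in> A \<Longrightarrow> plus x y = plus y x"
    and plus_zero: "x \<in> A \<Longrightarrow> plus x zero = x"
    and plus_one: "x \<in> A \<Longrightarrow> plus x one = one"
    and neg_zero: "neg zero = one"
    and neg_neg: "x \<in> A \<Longrightarrow> neg (neg x) = x"
    and lukasiewicz: "x \<in> A \<Longrightarrow> y \<in> A \<Longrightarrow>
      plus (neg (plus (neg x) y)) y = plus (neg (plus (neg y) x)) x"

text \<open>
  The signature of EMV-algebras: the lattice operations are \<open>sup\<close> and \<open>inf\<close>, and the constant
  \<open>0\<close> is \<open>bot\<close>.
\<close>

class emv_signature = distrib_lattice + order_bot +
  fixes oplus :: "'a \<Rightarrow> 'a \<Rightarrow> 'a"  (infixl "\<oplus>" 65)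
begin

definition idempotents :: "'a set" where
  "idempotents = {a. a \<oplus> a = a}"

definition is_relative_neg :: "'a \<Rightarrow> 'a \<Rightarrow> 'a \<Rightarrow> bool" where
  "is_relative_neg a x z \<longleftrightarrow>
     z \<in> {bot..a} \<and> z \<oplus> x = a \<and> (\<forall>w\<in>{bot..a}. w \<oplus> x = a \<longrightarrow> z \<le> w)"

text \<open>The element \<open>\<lambda>\<^sub>a(x)\<close>; \<open>THE\<close> is meaningful whenever the minimum exists.\<close>

definition relative_neg :: "'a \<Rightarrow> 'a \<Rightarrow> 'a" where
  "relative_neg a x = (THE z. is_relative_neg a x z)"

end

text \<open>
  The monoid is an \<^emph>\<open>ordered\<close> monoid (\<open>oplus_mono\<close>), as in the original definition of
  EMV-algebras.  Equivalently, the MV-algebra order of each interval \<open>[0,a]\<close> is the restriction of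
  the lattice order of \<open>M\<close>; the remaining axioms do not force the two orders to agree.
\<close>

class emv_algebra = emv_signature +
  assumes oplus_assoc: "(x \<oplus> y) \<oplus> z = x \<oplus> (y \<oplus> z)"
    and oplus_comm: "x \<oplus> y = y \<oplus> x"
    and oplus_bot: "x \<oplus> bot = x"
    and oplus_mono: "x \<le> y \<Longrightarrow> x \<oplus> z \<le> y \<oplus> z"
    and relative_neg_exists: "a \<in> idempotents \<Longrightarrow> x \<in> {bot..a} \<Longrightarrow> \<exists>z. is_relative_neg a x z"
    and interval_mv: "a \<in> idempotents \<Longrightarrow> mv_algebra_on {bot..a} (\<oplus>) (relative_neg a) bot a"
    and below_idempotent: "\<exists>a\<in>idempotents. x \<le> a"

text \<open>
  The value \<open>\<lambda>\<^sub>a(\<lambda>\<^sub>a(x) \<oplus> \<lambda>\<^sub>a(y))\<close> does not depend on the idempotent \<open>a \<ge> x, y\<close>, so any choice of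
  \<open>a\<close> will do.
\<close>

definition odot :: "'a::emv_algebra \<Rightarrow> 'a \<Rightarrow> 'a"  (infixl "\<odot>" 70) where
  "x \<odot> y = (let a = (SOME a. a \<in> idempotents \<and> x \<le> a \<and> y \<le> a)
            in relative_neg a (relative_neg a x \<oplus> relative_neg a y))"

text \<open>The partial sum \<open>x + y\<close> is defined iff \<open>x \<odot> y = 0\<close>, and is then equal to \<open>x \<oplus> y\<close>.\<close>

definition states :: "('a::emv_algebra \<Rightarrow> real) set" where
  "states = {s. (\<forall>x. s x \<in> {0..1}) \<and>
                (\<forall>x y. x \<odot> y = bot \<longrightarrow> s (x \<oplus> y) = s x + s y) \<and>
                (\<exists>a. s a = 1)}"

definition state_morphisms :: "('a::emv_algebra \<Rightarrow> real) set" where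
  "state_morphisms = {s. (\<forall>x. s x \<in> {0..1}) \<and>
                (\<forall>x y. s (sup x y) = max (s x) (s y)) \<and>
                (\<forall>x y. s (inf x y) = min (s x) (s y)) \<and>
                (\<forall>x y. s (x \<oplus> y) = min (s x + s y) 1) \<and>
                s bot = 0 \<and>
                (\<forall>b\<in>idempotents. \<forall>x\<in>{bot..b}. s (relative_neg b x) = s b - s x) \<and>
                (\<exists>a. s a = 1)}"

text \<open>
  The function type is not an instance of \<open>real_vector\<close>, so \<open>convex hull\<close> is not available for sets
  of real-valued functions.
\<close>

definition convex_combinations :: "('a \<Rightarrow> real) set \<Rightarrow> ('a \<Rightarrow> real) set" where
  "convex_combinations S =
     {\<lambda>x. \<Sum>i<n. c i * f i x | (n::nat) (c :: nat \<Rightarrow> real) f.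
        (\<forall>i<n. f i \<in> S \<and> c i \<ge> 0) \<and> (\<Sum>i<n. c i) = 1}"

definition weak_state_topology :: "('a::emv_algebra \<Rightarrow> real) topology" where
  "weak_state_topology =
     subtopology (product_topology (\<lambda>_. top_of_set {0..1}) UNIV) states"

end

theory Submission
  imports Defs
begin

text \<open>For a positive additive functional \<open>s\<close> and an element \<open>u\<close>, the part of \<open>s\<close> carried by \<open>u\<close>,
  \<open>x \<mapsto> sup\<^sub>n s (x \<and> n.u)\<close>, is again additive by Riesz decomposition; it vanishes at every \<open>v\<close>
  disjoint from \<open>u\<close>, and its complement in \<open>s\<close> vanishes at \<open>u\<close>.  Given a linear functional on
  finitely many coordinates, splitting along finitely many disjoint pairs and keeping the better
  part each time gives a state that is as large on the functional and is zero at one member of each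
  pair; compactness then handles all disjoint pairs at once.  A state that vanishes at one member of
  every disjoint pair is a state-morphism.  Hence no linear functional separates a state from the
  state-morphisms, and a greedy averaging argument (in place of the Hahn--Banach theorem) turns this
  into approximation by convex combinations.\<close>

section \<open>Residuation in EMV-algebras\<close>

lemma idempotent_above3:
  fixes x y z :: "'a::emv_algebra"
  obtains a where "a \<in> idempotents" "x \<le> a" "y \<le> a" "z \<le> a"
  using below_idempotent[of "sup x (sup y z)"] by auto

lemma is_relative_neg_relative_neg:
  fixes a x :: "'a::emv_algebra"
  assumes "a \<in> idempotents" "x \<le> a"
  shows "is_relative_neg a x (relative_neg a x)"
proof -
  obtain z where z: "is_relative_neg a x z"
    using relative_neg_exists[of a x] assms by auto
  moreover have "w = z" if "is_relative_neg a x w" for w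
    using that z unfolding is_relative_neg_def by (blast intro: antisym)
  ultimately show ?thesis
    unfolding relative_neg_def by (rule theI)
qed

lemma relative_neg_le:
  fixes a x :: "'a::emv_algebra"
  shows "a \<in> idempotents \<Longrightarrow> x \<le> a \<Longrightarrow> relative_neg a x \<le> a"
  using is_relative_neg_relative_neg[of a x] by (simp add: is_relative_neg_def)

lemma relative_neg_oplus:
  fixes a x :: "'a::emv_algebra"
  shows "a \<in> idempotents \<Longrightarrow> x \<le> a \<Longrightarrow> relative_neg a x \<oplus> x = a"
  using is_relative_neg_relative_neg[of a x] by (simp add: is_relative_neg_def)

lemma relative_neg_least:
  fixes a x :: "'a::emv_algebra"
  shows "a \<in> idempotents \<Longrightarrow> x \<le> a \<Longrightarrow> w \<le> a \<Longrightarrow> w \<oplus> x = a \<Longrightarrow> relative_neg a x \<le> w"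
  using is_relative_neg_relative_neg[of a x] by (simp add: is_relative_neg_def)

lemma relative_neg_relative_neg:
  fixes a x :: "'a::emv_algebra"
  shows "a \<in> idempotents \<Longrightarrow> x \<le> a \<Longrightarrow> relative_neg a (relative_neg a x) = x"
  using mv_algebra_on.neg_neg[OF interval_mv, of a x] by simp

lemma oplus_mono2:
  fixes x y :: "'a::emv_algebra"
  assumes "x \<le> x'" "y \<le> y'"
  shows "x \<oplus> y \<le> x' \<oplus> y'"
  by (metis assms oplus_comm oplus_mono order_trans)

lemma oplus_le_idempotent:
  fixes x y :: "'a::emv_algebra"
  shows "a \<in> idempotents \<Longrightarrow> x \<le> a \<Longrightarrow> y \<le> a \<Longrightarrow> x \<oplus> y \<le> a"
  using oplus_mono2[of x a y a] by (simp add: idempotents_def)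

lemma bot_oplus: "bot \<oplus> x = (x::'a::emv_algebra)"
  using oplus_bot[of x] by (simp add: oplus_comm)

lemma inf_bot: "inf x bot = (bot::'a::emv_algebra)"
  by (simp add: inf_absorb2)

lemma le_oplus1: "(x::'a::emv_algebra) \<le> x \<oplus> y"
  using oplus_mono2[of x x bot y] by (simp add: oplus_bot)

lemma le_oplus2: "(y::'a::emv_algebra) \<le> x \<oplus> y"
  using le_oplus1[of y x] by (simp add: oplus_comm)

text \<open>Forward, monotonicity of \<open>\<oplus>\<close> suffices. Backward, minimality gives
  \<open>relative_neg a y \<le> relative_neg a x\<close>, and negation is an antitone involution. So
  the MV-order of \<open>[0,a]\<close> is the lattice order.\<close>

lemma le_iff_relative_neg_oplus:
  fixes a x y :: "'a::emv_algebra"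
  assumes a: "a \<in> idempotents" "x \<le> a" "y \<le> a"
  shows "x \<le> y \<longleftrightarrow> relative_neg a x \<oplus> y = a"
proof -
  have anti: "relative_neg a v \<le> relative_neg a u" if "u \<le> v" "v \<le> a" for u v
  proof (rule relative_neg_least)
    have u: "u \<le> a" using that by simp
    show "relative_neg a u \<oplus> v = a"
      using oplus_mono2[of "relative_neg a u" "relative_neg a u" u v]
        oplus_le_idempotent[of a "relative_neg a u" v] relative_neg_le[OF a(1) u]
        relative_neg_oplus[OF a(1) u] that a(1) by (auto intro: antisym)
    show "relative_neg a u \<le> a" using relative_neg_le[OF a(1) u] .
  qed (use that a in auto)
  show ?thesis
  proof
    assume "x \<le> y"
    then show "relative_neg a x \<oplus> y = a"
      using oplus_mono2[of "relative_neg a x" "relative_neg a x" x y]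
        oplus_le_idempotent[of a "relative_neg a x" y] relative_neg_le[OF a(1,2)]
        relative_neg_oplus[OF a(1,2)] a by (auto intro: antisym)
  next
    assume "relative_neg a x \<oplus> y = a"
    then have "relative_neg a y \<le> relative_neg a x"
      using relative_neg_least[of a y] relative_neg_le a by blast
    then have "relative_neg a (relative_neg a x) \<le> relative_neg a (relative_neg a y)"
      using anti relative_neg_le a by blast
    then show "x \<le> y" using a by (simp add: relative_neg_relative_neg)
  qed
qed

text \<open>The truncated difference of MV-algebras; taking a least element frees it from the choice
  of an interval containing \<open>x\<close> and \<open>y\<close>.\<close>

definition residual :: "'a::emv_algebra \<Rightarrow> 'a \<Rightarrow> 'a"  (infixl "\<ominus>" 65) where
  "x \<ominus> y = (LEAST z. x \<le> y \<oplus> z)"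

lemma residual_interval:
  fixes a x y z :: "'a::emv_algebra"
  assumes "a \<in> idempotents" "x \<le> a" "y \<le> a" "z \<le> a"
  shows "relative_neg a (relative_neg a x \<oplus> y) \<le> z \<longleftrightarrow> x \<le> y \<oplus> z"
proof -
  let ?w = "relative_neg a x \<oplus> y"
  have w: "?w \<le> a" using assms by (simp add: oplus_le_idempotent relative_neg_le)
  have "relative_neg a ?w \<le> z \<longleftrightarrow> ?w \<oplus> z = a"
    using le_iff_relative_neg_oplus[of a "relative_neg a ?w" z] assms w
    by (simp add: relative_neg_le relative_neg_relative_neg)
  also have "\<dots> \<longleftrightarrow> x \<le> y \<oplus> z"
    using le_iff_relative_neg_oplus[of a x "y \<oplus> z"] assms
    by (simp add: oplus_le_idempotent oplus_assoc)
  finally show ?thesis .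
qed

text \<open>Each interval has its own truncated difference. For \<open>z\<close> outside
  \<open>[0,a]\<close>, a larger idempotent \<open>b\<close> bounds everything, and the differences
  formed in \<open>a\<close> and \<open>b\<close> agree by mutual minimality.\<close>

lemma residual_eq_least:
  fixes a x y :: "'a::emv_algebra"
  assumes a: "a \<in> idempotents" "x \<le> a" "y \<le> a"
  shows "x \<ominus> y = relative_neg a (relative_neg a x \<oplus> y)"
    and "x \<ominus> y \<le> z \<longleftrightarrow> x \<le> y \<oplus> z"
proof -
  define d where "d b = relative_neg b (relative_neg b x \<oplus> y)" for b
  have d: "d b \<le> z \<longleftrightarrow> x \<le> y \<oplus> z" if "b \<in> idempotents" "x \<le> b" "y \<le> b" "z \<le> b" for b z
    using residual_interval that by (auto simp: d_def)
  have da: "d b \<le> b" if "b \<in> idempotents" "x \<le> b" "y \<le> b" for b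
    unfolding d_def using that by (simp add: oplus_le_idempotent relative_neg_le)
  have x: "x \<le> y \<oplus> d a" using d[of a "d a"] da a by simp
  have least: "d a \<le> z" if z: "x \<le> y \<oplus> z" for z
  proof -
    obtain b where b: "b \<in> idempotents" "a \<le> b" "z \<le> b"
      by (rule idempotent_above3)
    then have xy: "x \<le> b" "y \<le> b" using a by auto
    have dab: "d a \<le> b" using da a b by (meson order_trans)
    have le: "d b \<le> d a" using d[OF b(1) xy dab] x by simp
    have "x \<le> y \<oplus> d b" using d[OF b(1) xy da[OF b(1) xy]] by simp
    \<comment> \<open>Being below \<open>d a\<close>, the element \<open>d b\<close> lies in
      \<open>[0,a]\<close>, where the minimality of \<open>d a\<close> applies to it.\<close>
    then have "d a \<le> d b" using d[OF a, of "d b"] le da[OF a] by (meson order_trans)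
    moreover have "d b \<le> z" using d[OF b(1) xy b(3)] z by simp
    ultimately show ?thesis by simp
  qed
  have eq: "x \<ominus> y = d a" unfolding residual_def
    by (rule Least_equality) (use x least in auto)
  then show "x \<ominus> y = relative_neg a (relative_neg a x \<oplus> y)" by (simp add: d_def)
  show "x \<ominus> y \<le> z \<longleftrightarrow> x \<le> y \<oplus> z"
    unfolding eq using x least oplus_mono2[of y y "d a" z] by (meson order_refl order_trans)
qed

lemma residual_le_iff: "(x::'a::emv_algebra) \<ominus> y \<le> z \<longleftrightarrow> x \<le> y \<oplus> z"
  by (rule idempotent_above3[of x y y]) (rule residual_eq_least(2))

lemma le_oplus_residual: "(x::'a::emv_algebra) \<le> y \<oplus> (x \<ominus> y)"
  using residual_le_iff by blast

lemma residual_le: "(x::'a::emv_algebra) \<ominus> y \<le> x"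
  by (simp add: residual_le_iff le_oplus2)

lemma residual_self: "(x::'a::emv_algebra) \<ominus> x = bot"
  using residual_le_iff[of x x bot] by (simp add: oplus_bot bot_unique)

lemma relative_neg_eq_residual:
  fixes a x :: "'a::emv_algebra"
  assumes "a \<in> idempotents" "x \<le> a"
  shows "relative_neg a x = a \<ominus> x"
proof -
  have "relative_neg a a = bot"
    using relative_neg_least[of a a bot] assms by (simp add: bot_oplus bot_unique)
  then show ?thesis
    using residual_eq_least(1)[of a a x] assms by (simp add: bot_oplus)
qed

text \<open>The Lukasiewicz axiom makes \<open>(u \<ominus> v) \<oplus> v\<close> symmetric in
  \<open>u\<close> and \<open>v\<close>. Enlarging \<open>x\<close> to \<open>sup x y\<close> and
  swapping leaves a residual equal to \<open>bot\<close>, which gives the upper bound.\<close>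

lemma residual_oplus: "(x \<ominus> y) \<oplus> y = sup x (y::'a::emv_algebra)"
proof (rule antisym)
  have comm: "(u \<ominus> v) \<oplus> v = (v \<ominus> u) \<oplus> u" for u v :: 'a
  proof -
    obtain a where a: "a \<in> idempotents" "u \<le> a" "v \<le> a" by (rule idempotent_above3)
    then show ?thesis
      using mv_algebra_on.lukasiewicz[OF interval_mv, of a u v]
        residual_eq_least(1)[of a u v] residual_eq_least(1)[of a v u] by simp
  qed
  have "x \<ominus> y \<le> sup x y \<ominus> y"
    using residual_le_iff le_oplus_residual sup.boundedE by metis
  then have "(x \<ominus> y) \<oplus> y \<le> (sup x y \<ominus> y) \<oplus> y" by (simp add: oplus_mono)
  also have "\<dots> = (y \<ominus> sup x y) \<oplus> sup x y" by (rule comm)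
  also have "y \<ominus> sup x y = bot"
    using residual_le_iff[of y "sup x y" bot] by (simp add: oplus_bot bot_unique)
  finally show "(x \<ominus> y) \<oplus> y \<le> sup x y" by (simp add: bot_oplus)
  show "sup x y \<le> (x \<ominus> y) \<oplus> y"
    using le_oplus_residual[of x y] by (simp add: le_oplus2 oplus_comm[of y])
qed

text \<open>By residuation, adding \<open>z\<close> is a right adjoint and so preserves
  meets.\<close>

lemma inf_oplus: "inf x y \<oplus> z = inf (x \<oplus> z) (y \<oplus> (z::'a::emv_algebra))"
proof (rule antisym)
  show "inf x y \<oplus> z \<le> inf (x \<oplus> z) (y \<oplus> z)" by (simp add: oplus_mono)
  have "inf (x \<oplus> z) (y \<oplus> z) \<ominus> z \<le> inf x y"
    by (simp add: residual_le_iff oplus_comm[of z])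
  then show "inf (x \<oplus> z) (y \<oplus> z) \<le> inf x y \<oplus> z"
    by (simp only: residual_le_iff oplus_comm[of z])
qed

lemma residual_inf: "x \<ominus> inf x y = x \<ominus> (y::'a::emv_algebra)"
proof -
  have "x \<ominus> inf x y \<le> z \<longleftrightarrow> x \<ominus> y \<le> z" for z
    by (simp add: residual_le_iff inf_oplus le_oplus1)
  then show ?thesis by (meson antisym order_refl)
qed

lemma sup_residual: "sup x y \<ominus> y = x \<ominus> (y::'a::emv_algebra)"
proof -
  have "sup x y \<ominus> y \<le> z \<longleftrightarrow> x \<ominus> y \<le> z" for z
    by (simp add: residual_le_iff le_oplus1)
  then show ?thesis by (meson antisym order_refl)
qed

text \<open>De Morgan dual of \<open>residual_oplus\<close>: written with
  \<open>relative_neg a\<close>, the left side becomes the negation of a join.\<close>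

lemma oplus_residual:
  fixes a x y :: "'a::emv_algebra"
  assumes a: "a \<in> idempotents" "x \<le> a" "y \<le> a"
  shows "(x \<oplus> y) \<ominus> y = inf x (a \<ominus> y)"
proof -
  define n where "n = relative_neg a"
  have n: "n (n u) = u" "n u \<le> a" if "u \<le> a" for u
    using that a by (auto simp: n_def relative_neg_relative_neg relative_neg_le)
  have anti: "n u \<le> n v \<longleftrightarrow> v \<le> u" if "u \<le> a" "v \<le> a" for u v
    using le_iff_relative_neg_oplus[of a "n u" "n v"] le_iff_relative_neg_oplus[of a v u] n that a
    by (simp add: n_def oplus_comm)
  have "(x \<oplus> y) \<ominus> y = n (n (n (n x) \<oplus> y) \<oplus> y)"
    using residual_eq_least(1)[of a "x \<oplus> y" y] a n oplus_le_idempotent[OF a]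
    by (simp add: n_def)
  also have "n (n (n x) \<oplus> y) = n x \<ominus> y"
    using residual_eq_least(1)[of a "n x" y] a n by (simp add: n_def)
  also have "(n x \<ominus> y) \<oplus> y = sup (n x) y" by (rule residual_oplus)
  also have "n (sup (n x) y) = inf x (n y)"
  proof (rule antisym)
    have s: "sup (n x) y \<le> a" using a n by simp
    show "n (sup (n x) y) \<le> inf x (n y)"
      using anti[OF s, of "n x"] anti[OF s, of y] a n by simp
    let ?i = "inf x (n y)"
    have i: "?i \<le> a" using a by (simp add: le_infI1)
    have "sup (n x) y \<le> n ?i"
      using anti[of x ?i] anti[of "n y" ?i] i a n by simp
    then show "?i \<le> n (sup (n x) y)"
      using anti[of "n ?i" "sup (n x) y"] s i n by simp
  qed
  finally show ?thesis
    using a by (simp add: n_def relative_neg_eq_residual)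
qed

section \<open>Orthogonality and Riesz decomposition\<close>

lemma odot_eq_bot_iff_le:
  fixes a x y :: "'a::emv_algebra"
  assumes "a \<in> idempotents" "x \<le> a" "y \<le> a"
  shows "x \<odot> y = bot \<longleftrightarrow> x \<le> a \<ominus> y"
proof -
  \<comment> \<open>The right-hand condition mentions no idempotent, so it carries the criterion
    from the idempotent chosen inside \<open>\<odot>\<close> over to \<open>a\<close>.\<close>
  have key: "(relative_neg b (relative_neg b x \<oplus> relative_neg b y) = bot) = ((x \<oplus> y) \<ominus> y = x)"
    if b: "b \<in> idempotents" "x \<le> b" "y \<le> b" for b
  proof -
    have "relative_neg b (relative_neg b x \<oplus> relative_neg b y) = x \<ominus> relative_neg b y"
      using residual_eq_least(1)[of b x "relative_neg b y"] b relative_neg_le[OF b(1,3)] by simp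
    also have "\<dots> = bot \<longleftrightarrow> x \<le> b \<ominus> y"
      using residual_le_iff[of x "relative_neg b y" bot] b
      by (simp add: relative_neg_eq_residual oplus_bot bot_unique)
    also have "\<dots> \<longleftrightarrow> (x \<oplus> y) \<ominus> y = x"
      using oplus_residual[OF b] by (simp add: le_iff_inf)
    finally show ?thesis .
  qed
  define b where "b = (SOME a. a \<in> idempotents \<and> x \<le> a \<and> y \<le> a)"
  have b: "b \<in> idempotents \<and> x \<le> b \<and> y \<le> b"
    unfolding b_def by (rule someI[of _ a]) (use assms in auto)
  have "x \<odot> y = bot \<longleftrightarrow> (x \<oplus> y) \<ominus> y = x"
    using key[of b] b by (simp add: odot_def Let_def flip: b_def)
  then show ?thesis
    using oplus_residual[OF assms] by (simp add: le_iff_inf)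
qed

lemma odot_eq_bot_iff:
  fixes x y :: "'a::emv_algebra"
  shows "x \<odot> y = bot \<longleftrightarrow> (x \<oplus> y) \<ominus> y = x"
proof -
  obtain a where "a \<in> idempotents" "x \<le> a" "y \<le> a" by (rule idempotent_above3)
  then show ?thesis
    by (simp add: odot_eq_bot_iff_le oplus_residual le_iff_inf)
qed

lemma odot_eq_bot_mono:
  fixes x y :: "'a::emv_algebra"
  assumes "x \<odot> y = bot" "x' \<le> x" "y' \<le> y"
  shows "x' \<odot> y' = bot"
proof -
  obtain a where a: "a \<in> idempotents" "x \<le> a" "y \<le> a" by (rule idempotent_above3)
  have "a \<ominus> y \<le> a \<ominus> y'"
    using le_oplus_residual[of a y'] oplus_mono[OF assms(3)] order_trans
    by (fastforce simp: residual_le_iff)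
  then have "x' \<le> a \<ominus> y'"
    using odot_eq_bot_iff_le[OF a] assms by simp
  then show ?thesis
    using odot_eq_bot_iff_le[of a x' y'] a assms by (meson order_trans)
qed

lemma residual_odot_right: "(x \<ominus> y) \<odot> (y::'a::emv_algebra) = bot"
  by (simp add: odot_eq_bot_iff residual_oplus sup_residual)

text \<open>With \<open>residual_oplus_inf\<close>, this makes \<open>x\<close> a defined partial
  sum of a piece above \<open>y\<close> and a piece below \<open>y\<close>; additive maps are
  computed through this decomposition.\<close>

lemma residual_odot_inf: "(x \<ominus> y) \<odot> inf x (y::'a::emv_algebra) = bot"
  by (rule odot_eq_bot_mono[OF residual_odot_right]) auto

lemma residual_oplus_inf: "(x \<ominus> y) \<oplus> inf x y = (x::'a::emv_algebra)"
  using residual_oplus[of x "inf x y"] by (simp add: residual_inf sup_absorb1)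

text \<open>Adding \<open>?d\<close> to \<open>?c\<close> changes nothing, because both full
  residuals add up to \<open>x\<close> and \<open>y\<close>. Orthogonality allows cancelling
  \<open>?c\<close>, so \<open>?d\<close> is \<open>?c \<ominus> ?c\<close>. This is the source of
  the disjoint pairs used later.\<close>

lemma inf_residual_residual: "inf (x \<ominus> y) (y \<ominus> x) = (bot::'a::emv_algebra)"
proof -
  let ?d = "inf (x \<ominus> y) (y \<ominus> x)" and ?c = "inf x y"
  have "?d \<oplus> ?c = ?c"
    using residual_oplus_inf[of x y] residual_oplus_inf[of y x]
    by (simp add: inf_oplus inf_commute[of y x])
  moreover have "?d \<odot> ?c = bot"
    by (rule odot_eq_bot_mono[OF residual_odot_inf[of x y]]) auto
  then have "(?d \<oplus> ?c) \<ominus> ?c = ?d"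
    by (simp only: odot_eq_bot_iff)
  ultimately show ?thesis
    by (simp only: residual_self)
qed

section \<open>Splitting a positive functional along an element\<close>

text \<open>A state without upper bound and normalisation, since the summands of a split state are
  in general not states.\<close>

definition positive_additive :: "('a::emv_algebra \<Rightarrow> real) \<Rightarrow> bool" where
  "positive_additive s \<longleftrightarrow>
     (\<forall>x. 0 \<le> s x) \<and> (\<forall>x y. x \<odot> y = bot \<longrightarrow> s (x \<oplus> y) = s x + s y)"

lemma positive_additive_decomp:
  assumes "positive_additive s"
  shows "s x = s (x \<ominus> y) + s (inf x y)"
  using assms residual_odot_inf[of x y] residual_oplus_inf[of x y]
  unfolding positive_additive_def by metis

lemma positive_additive_mono:
  assumes "positive_additive s" "x \<le> y"
  shows "s x \<le> s y"
  using positive_additive_decomp[OF assms(1), of y x] assms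
  by (simp add: positive_additive_def inf_absorb2)

lemma positive_additive_bot:
  assumes "positive_additive s"
  shows "s bot = 0"
  using positive_additive_decomp[OF assms, of bot bot] by (simp add: residual_self)

fun multiple :: "nat \<Rightarrow> 'a::emv_algebra \<Rightarrow> 'a" where
  "multiple 0 u = bot"
| "multiple (Suc n) u = multiple n u \<oplus> u"

lemma multiple_add: "multiple (m + n) u = multiple m u \<oplus> multiple n u"
  by (induction n) (simp_all add: oplus_bot oplus_assoc)

lemma inf_multiple_eq_bot:
  fixes u v :: "'a::emv_algebra"
  assumes "inf u v = bot"
  shows "inf v (multiple n u) = bot"
proof (induction n)
  case (Suc n)
  \<comment> \<open>Decomposing \<open>?w\<close> at \<open>multiple n u\<close> gives a residual
    below both \<open>u\<close> and \<open>v\<close>, and a meet that is \<open>bot\<close> by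
    induction.\<close>
  let ?w = "inf v (multiple n u \<oplus> u)"
  have "?w \<ominus> multiple n u \<le> inf u v"
    by (simp add: residual_le_iff le_infI1 le_oplus2)
  moreover have "inf ?w (multiple n u) \<le> inf v (multiple n u)"
    by (simp add: le_infI1)
  ultimately have "?w \<ominus> multiple n u = bot" "inf ?w (multiple n u) = bot"
    using Suc assms by (simp_all add: bot_unique)
  then show ?case
    using residual_oplus_inf[of ?w "multiple n u"] by (simp add: oplus_bot)
qed (simp add: inf_bot)

definition part_along :: "'a::emv_algebra \<Rightarrow> ('a \<Rightarrow> real) \<Rightarrow> 'a \<Rightarrow> real" where
  "part_along u s x = (SUP n. s (inf x (multiple n u)))"

context
  fixes s :: "'a::emv_algebra \<Rightarrow> real"
  assumes s: "positive_additive s"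
begin

lemma le_part: "s (inf x (multiple n u)) \<le> part_along u s x"
  unfolding part_along_def
  by (rule cSUP_upper) (auto intro!: bdd_aboveI2[of _ _ "s x"] positive_additive_mono[OF s])

lemma part_leI: "(\<And>n. s (inf x (multiple n u)) \<le> c) \<Longrightarrow> part_along u s x \<le> c"
  unfolding part_along_def by (rule cSUP_least) auto

lemma part_le: "part_along u s x \<le> s x"
  by (rule part_leI) (auto intro: positive_additive_mono[OF s])

lemma positive_additive_part: "positive_additive (part_along u s)"
  unfolding positive_additive_def
proof (intro conjI allI impI)
  show "0 \<le> part_along u s x" for x
    using le_part[of x 0 u] s by (simp add: inf_bot positive_additive_bot)
  fix x y :: 'a
  assume xy: "x \<odot> y = bot"
  show "part_along u s (x \<oplus> y) = part_along u s x + part_along u s y"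
  proof (rule antisym)
    \<comment> \<open>Upper bound: decomposing the truncated sum at \<open>x\<close> gives one piece
      below \<open>x\<close> and one below \<open>y\<close>, both still below the multiple of
      \<open>u\<close>.\<close>
    show "part_along u s (x \<oplus> y) \<le> part_along u s x + part_along u s y"
    proof (rule part_leI)
      fix n
      let ?w = "inf (x \<oplus> y) (multiple n u)"
      have "inf ?w x \<le> inf x (multiple n u)"
        by (simp add: le_infI1)
      moreover have "?w \<ominus> x \<le> inf y (multiple n u)"
        using residual_le[of ?w x] by (simp add: residual_le_iff)
      ultimately have "s ?w \<le> s (inf y (multiple n u)) + s (inf x (multiple n u))"
        using positive_additive_decomp[OF s, of ?w x] positive_additive_mono[OF s] add_mono
        by metis
      then show "s ?w \<le> part_along u s x + part_along u s y"
        using le_part[of x n u] le_part[of y n u] by linarith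
    qed
    \<comment> \<open>Lower bound: the two truncations stay orthogonal and their sum is below the
      multiple \<open>n + m\<close>. Independent indices let the suprema be taken one at a
      time.\<close>
    have "s (inf x (multiple n u)) + s (inf y (multiple m u)) \<le> part_along u s (x \<oplus> y)" for n m
    proof -
      let ?x = "inf x (multiple n u)" and ?y = "inf y (multiple m u)"
      have "?x \<odot> ?y = bot" by (rule odot_eq_bot_mono[OF xy]) auto
      then have "s ?x + s ?y = s (?x \<oplus> ?y)"
        using s by (simp add: positive_additive_def)
      also have "\<dots> \<le> s (inf (x \<oplus> y) (multiple (n + m) u))"
        by (intro positive_additive_mono[OF s]) (simp add: multiple_add oplus_mono2)
      also have "\<dots> \<le> part_along u s (x \<oplus> y)" by (rule le_part)
      finally show ?thesis .
    qed
    then have "part_along u s x \<le> part_along u s (x \<oplus> y) - s (inf y (multiple m u))" for m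
      by (intro part_leI) (simp add: le_diff_eq)
    then have "part_along u s y \<le> part_along u s (x \<oplus> y) - part_along u s x"
      by (intro part_leI) (simp add: le_diff_eq algebra_simps)
    then show "part_along u s x + part_along u s y \<le> part_along u s (x \<oplus> y)" by simp
  qed
qed

lemma positive_additive_diff_part: "positive_additive (\<lambda>x. s x - part_along u s x)"
  using positive_additive_part[of u] s part_le by (auto simp: positive_additive_def)

lemma part_self: "part_along u s u = s u"
  using le_part[of u 1 u] part_le[of u u] by (simp add: bot_oplus)

lemma part_disjoint:
  assumes "inf u v = bot"
  shows "part_along u s v = 0"
  by (simp add: part_along_def inf_multiple_eq_bot[OF assms] positive_additive_bot[OF s])

end

text \<open>The excess of \<open>sup x a\<close> over \<open>a\<close> is null for \<open>s\<close>,
  hence null for the dominated \<open>r\<close>. So \<open>a\<close> keeps acting as a unit for the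
  summands of \<open>s\<close>.\<close>

lemma dominated_bounded:
  assumes s: "positive_additive s" "\<And>x. s x \<le> s a"
    and r: "positive_additive r" "\<And>x. r x \<le> s x"
  shows "r x \<le> r a"
proof -
  have "s (sup x a \<ominus> a) = 0"
    using positive_additive_decomp[OF s(1), of "sup x a" a] s(2)[of "sup x a"] s(1)
    by (simp add: inf_absorb2 positive_additive_def order.antisym)
  then have "r (sup x a \<ominus> a) \<le> 0"
    using r(2)[of "sup x a \<ominus> a"] by simp
  then have "r (sup x a) \<le> r a"
    using positive_additive_decomp[OF r(1), of "sup x a" a] by (simp add: inf_absorb2)
  then show ?thesis
    using positive_additive_mono[OF r(1), of x "sup x a"] by simp
qed

text \<open>Since \<open>s = part_along u s + (s - part_along u s)\<close>, one of the two summands inherits the linear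
  inequality.  The first vanishes at \<open>v\<close>, the second at \<open>u\<close>, and zeros of \<open>s\<close> are zeros of
  both.  Strictness of the inequality keeps the chosen summand nonzero.\<close>

lemma exists_vanishing_on_pairs:
  fixes s :: "'a::emv_algebra \<Rightarrow> real"
  assumes "finite P" "\<And>u v. (u, v) \<in> P \<Longrightarrow> inf u v = bot"
    and "positive_additive s" "\<And>x. s x \<le> s a" "c * s a < (\<Sum>x\<in>F. k x * s x)"
  shows "\<exists>r. positive_additive r \<and> (\<forall>x. r x \<le> r a) \<and> c * r a < (\<Sum>x\<in>F. k x * r x) \<and>
    (\<forall>(u, v)\<in>P. r u = 0 \<or> r v = 0)"
  using assms(1,2)
proof (induction P rule: finite_induct)
  case empty
  then show ?case using assms(3-5) by auto
next
  case (insert p P)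
  obtain u v where p: "p = (u, v)" by (cases p)
  have uv: "inf u v = bot" using insert.prems p by simp
  obtain r where r: "positive_additive r" "\<And>x. r x \<le> r a" "c * r a < (\<Sum>x\<in>F. k x * r x)"
      "\<And>u v. (u, v) \<in> P \<Longrightarrow> r u = 0 \<or> r v = 0"
    using insert.IH insert.prems by blast
  let ?q = "part_along u r" and ?d = "\<lambda>x. r x - part_along u r x"
  have pos: "positive_additive ?q" "positive_additive ?d"
    using r(1) by (auto intro: positive_additive_part positive_additive_diff_part)
  have nonneg: "0 \<le> ?q x" "0 \<le> ?d x" for x
    using pos by (auto simp: positive_additive_def)
  have dom: "?q x \<le> r x" "?d x \<le> r x" for x
    using nonneg[of x] by auto
  have zero: "?q x = 0" "?d x = 0" if "r x = 0" for x
    using dom[of x] nonneg[of x] that by auto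
  have "c * ?q a < (\<Sum>x\<in>F. k x * ?q x) \<or> c * ?d a < (\<Sum>x\<in>F. k x * ?d x)"
    using r(3) by (simp add: right_diff_distrib sum_subtractf) linarith
  then show ?case
  proof
    assume "c * ?q a < (\<Sum>x\<in>F. k x * ?q x)"
    moreover have "?q v = 0" by (rule part_disjoint[OF r(1) uv])
    moreover have "\<forall>(u, v)\<in>P. ?q u = 0 \<or> ?q v = 0" using r(4) zero(1) by blast
    ultimately show ?thesis
      using pos(1) dominated_bounded[OF r(1,2) pos(1) dom(1)] p by (intro exI[of _ ?q]) auto
  next
    assume "c * ?d a < (\<Sum>x\<in>F. k x * ?d x)"
    moreover have "?d u = 0" by (simp add: part_self[OF r(1)])
    moreover have "\<forall>(u, v)\<in>P. ?d u = 0 \<or> ?d v = 0" using r(4) zero(2) by blast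
    ultimately show ?thesis
      using pos(2) dominated_bounded[OF r(1,2) pos(2) dom(2)] p by (intro exI[of _ ?d]) auto
  qed
qed

section \<open>State-morphisms\<close>

text \<open>One of the disjoint elements \<open>x \<ominus> y\<close> and
  \<open>y \<ominus> x\<close> is null, which turns the decomposition at the meet into a minimum.
  The other operations reduce to meets and residuals.\<close>

lemma state_morphismI:
  fixes s :: "'a::emv_algebra \<Rightarrow> real"
  assumes s: "positive_additive s" "\<And>x. s x \<le> 1" "s a = 1"
    and disj: "\<And>u v. inf u v = bot \<Longrightarrow> s u = 0 \<or> s v = 0"
  shows "s \<in> state_morphisms"
proof -
  have nonneg: "0 \<le> s x" for x using s(1) by (simp add: positive_additive_def)
  have inf: "s (inf x y) = min (s x) (s y)" for x y
    using disj[OF inf_residual_residual[of x y]] nonneg[of "x \<ominus> y"] nonneg[of "y \<ominus> x"]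
      positive_additive_decomp[OF s(1), of x y] positive_additive_decomp[OF s(1), of y x]
    by (auto simp: inf_commute[of y x])
  have sup: "s (sup x y) = max (s x) (s y)" for x y
    using positive_additive_decomp[OF s(1), of "sup x y" y]
      positive_additive_decomp[OF s(1), of x y] inf[of x y]
    by (simp add: sup_residual inf_absorb2)
  have diff: "s (b \<ominus> x) = s b - s x" if "x \<le> b" for b x
    using positive_additive_decomp[OF s(1), of b x] that by (simp add: inf_absorb2)
  have plus: "s (x \<oplus> y) = min (s x + s y) 1" for x y
  proof -
    \<comment> \<open>Placing \<open>a\<close> below \<open>b\<close> forces \<open>s b = 1\<close>;
      the truncation at 1 then comes from the meet with \<open>b \<ominus> y\<close>.\<close>
    obtain b where b: "b \<in> idempotents" "x \<le> b" "y \<le> b" "a \<le> b" by (rule idempotent_above3)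
    have "s b = 1"
      using positive_additive_mono[OF s(1) b(4)] s(2)[of b] s(3) by simp
    then have "s ((x \<oplus> y) \<ominus> y) = min (s x) (1 - s y)"
      using oplus_residual[OF b(1-3)] inf diff[OF b(3)] by simp
    then show ?thesis
      using positive_additive_decomp[OF s(1), of "x \<oplus> y" y]
      by (simp add: inf_absorb2 le_oplus2)
  qed
  show ?thesis
    unfolding state_morphisms_def
    using nonneg s inf sup plus diff positive_additive_bot[OF s(1)]
    by (auto simp: relative_neg_eq_residual)
qed

lemma state_morphisms_subset_states: "state_morphisms \<subseteq> states"
proof
  fix s :: "'a \<Rightarrow> real"
  assume s: "s \<in> state_morphisms"
  have "s (x \<oplus> y) = s x + s y" if "x \<odot> y = bot" for x y
  proof -
    obtain b where b: "b \<in> idempotents" "x \<le> b" "y \<le> b" by (rule idempotent_above3)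
    \<comment> \<open>Orthogonality puts \<open>x\<close> below the negation of \<open>y\<close>, so
      \<open>s x + s y \<le> 1\<close> and the truncated sum is the ordinary one.\<close>
    have "sup x (relative_neg b y) = relative_neg b y"
      using odot_eq_bot_iff_le[OF b] that b by (simp add: relative_neg_eq_residual sup_absorb2)
    moreover have "s (sup x (relative_neg b y)) = max (s x) (s (relative_neg b y))"
      using s by (simp add: state_morphisms_def)
    ultimately have "s x \<le> s (relative_neg b y)" by simp
    also have "\<dots> \<le> 1 - s y"
      using s b by (simp add: state_morphisms_def)
    finally show ?thesis using s by (simp add: state_morphisms_def)
  qed
  then show "s \<in> states" using s by (simp add: state_morphisms_def states_def)
qed

lemma states_positive_additive: "s \<in> states \<Longrightarrow> positive_additive s"
  by (simp add: states_def positive_additive_def)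

lemma convex_combinations_states: "convex_combinations states \<subseteq> states"
proof
  fix g :: "'a \<Rightarrow> real"
  assume "g \<in> convex_combinations states"
  then obtain n :: nat and c f where g: "g = (\<lambda>x. \<Sum>i<n. c i * f i x)"
    and f: "\<And>i. i < n \<Longrightarrow> f i \<in> states" and c: "\<And>i. i < n \<Longrightarrow> 0 \<le> c i" "(\<Sum>i<n. c i) = 1"
    unfolding convex_combinations_def by auto
  have range: "0 \<le> f i x" "f i x \<le> 1" if "i < n" for i x
    using f[OF that] by (auto simp: states_def)
  \<comment> \<open>The combination attains 1 at an element where all components do; joining their
    individual witnesses gives one, by monotonicity.\<close>
  have "\<exists>a. \<forall>i<m. f i a = 1" if "m \<le> n" for m
    using that
  proof (induction m)
    case (Suc m)
    then obtain a where a: "\<forall>i<m. f i a = 1" by auto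
    have "f m \<in> states" using f Suc.prems by simp
    then obtain b where b: "f m b = 1" by (auto simp: states_def)
    have "f i (sup a b) = 1" if "i < Suc m" for i
    proof -
      have i: "i < n" using that Suc.prems by simp
      have "f i a \<le> f i (sup a b)" "f i b \<le> f i (sup a b)"
        by (simp_all add: positive_additive_mono[OF states_positive_additive[OF f[OF i]]])
      moreover have "f i a = 1 \<or> f i b = 1"
        using a b that less_Suc_eq by blast
      ultimately show ?thesis
        using range(2)[OF i, of "sup a b"] by linarith
    qed
    then show ?case by blast
  qed simp
  then obtain a where "\<forall>i<n. f i a = 1" by blast
  then have "g a = 1" using c(2) by (simp add: g)
  moreover have "0 \<le> g x" for x
    unfolding g by (intro sum_nonneg mult_nonneg_nonneg) (auto simp: c(1) range)
  moreover have "g x \<le> 1" for x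
  proof -
    have "g x \<le> (\<Sum>i<n. c i)"
      unfolding g by (intro sum_mono mult_left_le) (auto simp: c(1) range)
    then show ?thesis by (simp add: c(2))
  qed
  moreover have "g (x \<oplus> y) = g x + g y" if "x \<odot> y = bot" for x y
  proof -
    have "g (x \<oplus> y) = (\<Sum>i<n. c i * f i x + c i * f i y)"
      unfolding g by (intro sum.cong) (use f that in \<open>auto simp: states_def distrib_left\<close>)
    then show ?thesis by (simp add: g sum.distrib)
  qed
  ultimately show "g \<in> states" by (auto simp: states_def)
qed

section \<open>Compactness over all disjoint pairs\<close>

lemma closed_zero_coordinates: "closed {r :: 'a \<Rightarrow> real. r u = 0 \<or> r v = 0}"
  by (intro closed_Collect_disj closed_Collect_eq continuous_on_product_coordinates
      continuous_on_const)

text \<open>Finite intersection property in the compact cube \<open>K\<close>: finitely many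
  disjoint pairs are handled by normalising the functional from
  \<open>exists_vanishing_on_pairs\<close>, and a point common to all the closed conditions is a
  state-morphism.\<close>

lemma exists_state_morphism_sum_ge:
  fixes s :: "'a::emv_algebra \<Rightarrow> real"
  assumes s: "s \<in> states" and c: "c < (\<Sum>x\<in>F. k x * s x)"
  shows "\<exists>m\<in>state_morphisms. c \<le> (\<Sum>x\<in>F. k x * m x)"
proof -
  obtain a where a: "s a = 1" using s by (auto simp: states_def)
  define K where "K = {r :: 'a \<Rightarrow> real. \<forall>x. r x \<in> {0..1}}"
  \<comment> \<open>Normalisation at one fixed \<open>a\<close> is a closed condition, whereas
    attaining 1 somewhere need not survive limits. The inequality is weakened to
    \<open>\<le>\<close> for closedness as well.\<close>
  define C where "C = {r :: 'a \<Rightarrow> real. (\<forall>x y. x \<odot> y = bot \<longrightarrow> r (x \<oplus> y) = r x + r y) \<and> r a = 1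
    \<and> c \<le> (\<Sum>x\<in>F. k x * r x)}"
  define Z where "Z = (\<lambda>(u, v). {r :: 'a \<Rightarrow> real. r u = 0 \<or> r v = 0})"
  define D where "D = {(u, v :: 'a). inf u v = bot}"
  have "compact K"
  proof -
    have "compactin (product_topology (\<lambda>_. euclidean) UNIV) (PiE UNIV (\<lambda>_::'a. {0..1::real}))"
      by (simp add: compactin_PiE)
    moreover have "PiE UNIV (\<lambda>_::'a. {0..1::real}) = K"
      by (auto simp: K_def PiE_def Pi_def)
    ultimately show ?thesis
      by (simp add: euclidean_product_topology)
  qed
  have "closed C"
    unfolding C_def
    by (intro closed_Collect_conj closed_Collect_all closed_Collect_imp open_Collect_const
        closed_Collect_eq closed_Collect_le continuous_intros continuous_on_product_coordinates)
  have ex: "K \<inter> C \<inter> \<Inter> (Z ` P) \<noteq> {}" if P: "finite P" "P \<subseteq> D" for P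
  proof -
    have "\<exists>r. positive_additive r \<and> (\<forall>x. r x \<le> r a) \<and> c * r a < (\<Sum>x\<in>F. k x * r x) \<and>
        (\<forall>(u, v)\<in>P. r u = 0 \<or> r v = 0)"
      by (rule exists_vanishing_on_pairs[OF P(1) _ states_positive_additive[OF s]])
        (use P s a c in \<open>auto simp: D_def states_def\<close>)
    then obtain r where r: "positive_additive r" "\<And>x. r x \<le> r a" "c * r a < (\<Sum>x\<in>F. k x * r x)"
        "\<forall>(u, v)\<in>P. r u = 0 \<or> r v = 0"
      by blast
    have nonneg: "0 \<le> r x" for x using r(1) by (simp add: positive_additive_def)
    \<comment> \<open>The strict inequality excludes the zero functional, so division by
      \<open>r a\<close> is possible.\<close>
    have "r a \<noteq> 0"
    proof
      assume "r a = 0"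
      then have "r x = 0" for x using r(2)[of x] nonneg[of x] by simp
      then show False using r(3) by simp
    qed
    then have ra: "0 < r a" using nonneg[of a] by simp
    let ?q = "\<lambda>x. r x / r a"
    have "?q \<in> K" using nonneg r(2) ra by (simp add: K_def)
    moreover have "?q \<in> C"
      using r(1,3) ra by (simp add: C_def positive_additive_def add_divide_distrib le_divide_eq
          flip: sum_divide_distrib)
    moreover have "?q \<in> \<Inter> (Z ` P)" using r(4) by (auto simp: Z_def)
    ultimately show ?thesis by blast
  qed
  have "(K \<inter> C) \<inter> \<Inter> (Z ` D) \<noteq> {}"
  proof (rule compact_imp_fip)
    show "compact (K \<inter> C)" using \<open>compact K\<close> \<open>closed C\<close> by (rule compact_Int_closed)
    show "closed T" if "T \<in> Z ` D" for T
      using that closed_zero_coordinates by (auto simp: Z_def)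
    show "(K \<inter> C) \<inter> \<Inter> F' \<noteq> {}" if "finite F'" "F' \<subseteq> Z ` D" for F'
      using ex finite_subset_image[OF that] by metis
  qed
  then obtain m where m: "m \<in> K" "m \<in> C" "m \<in> \<Inter> (Z ` D)" by blast
  have "m \<in> state_morphisms"
  proof (rule state_morphismI)
    show "positive_additive m" using m(1,2) by (simp add: K_def C_def positive_additive_def)
    show "m x \<le> 1" for x using m(1) by (simp add: K_def)
    show "m a = 1" using m(2) by (simp add: C_def)
    show "m u = 0 \<or> m v = 0" if "inf u v = bot" for u v
      using m(3) that by (auto simp: Z_def D_def)
  qed
  moreover have "c \<le> (\<Sum>x\<in>F. k x * m x)" using m(2) by (simp add: C_def)
  ultimately show ?thesis by blast
qed

section \<open>Approximation by averages of state-morphisms\<close>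

text \<open>Each new state-morphism is chosen to make an almost nonpositive inner product with the
  accumulated error, so the squared error of the sum grows only linearly.\<close>

lemma exists_state_morphism_sequence:
  fixes s :: "'a::emv_algebra \<Rightarrow> real"
  assumes s: "s \<in> states" and "finite F"
  shows "\<exists>f. (\<forall>i<n. f i \<in> state_morphisms) \<and>
    (\<Sum>x\<in>F. (\<Sum>i<n. f i x - s x)\<^sup>2) \<le> real n * (real (card F) + 1)"
proof (induction n)
  case (Suc n)
  then obtain f where f: "\<And>i. i < n \<Longrightarrow> f i \<in> state_morphisms"
    "(\<Sum>x\<in>F. (\<Sum>i<n. f i x - s x)\<^sup>2) \<le> real n * (real (card F) + 1)" by blast
  define e where "e x = (\<Sum>i<n. f i x - s x)" for x
  \<comment> \<open>The existence lemma needs a bound strictly below the value at \<open>s\<close>.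
    The slack \<open>1 / 2\<close> is doubled in the cross term and becomes the \<open>+ 1\<close>
    in the estimate.\<close>
  obtain m where m: "m \<in> state_morphisms"
    and le: "(\<Sum>x\<in>F. - e x * s x) - 1 / 2 \<le> (\<Sum>x\<in>F. - e x * m x)"
    using exists_state_morphism_sum_ge[OF s, where F = F and k = "\<lambda>x. - e x"
        and c = "(\<Sum>x\<in>F. - e x * s x) - 1 / 2"] by auto
  have "(\<Sum>x\<in>F. (m x - s x)\<^sup>2) \<le> (\<Sum>x\<in>F. 1)"
  proof (rule sum_mono)
    fix x
    have "\<bar>m x - s x\<bar> \<le> 1"
      using m s by (simp add: state_morphisms_def states_def abs_le_iff) (smt (verit))
    then show "(m x - s x)\<^sup>2 \<le> 1" by (simp add: abs_square_le_1)
  qed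
  moreover have "(\<Sum>x\<in>F. (e x + (m x - s x))\<^sup>2)
      = (\<Sum>x\<in>F. (e x)\<^sup>2) + 2 * (\<Sum>x\<in>F. e x * (m x - s x)) + (\<Sum>x\<in>F. (m x - s x)\<^sup>2)"
    by (simp add: power2_sum sum.distrib sum_distrib_left mult.assoc add.commute add.left_commute)
  moreover have "(\<Sum>x\<in>F. e x * (m x - s x)) \<le> 1 / 2"
    using le by (simp add: right_diff_distrib sum_subtractf sum_negf)
  ultimately have "(\<Sum>x\<in>F. (e x + (m x - s x))\<^sup>2) \<le> real (Suc n) * (real (card F) + 1)"
    using f(2) by (simp add: e_def[symmetric] algebra_simps)
  then show ?case
    using f(1) m by (intro exI[of _ "f(n := m)"]) (auto simp: e_def less_Suc_eq)
qed simp

lemma exists_convex_combination_approx: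
  fixes s :: "'a::emv_algebra \<Rightarrow> real"
  assumes s: "s \<in> states" and F: "finite F" and e: "0 < e"
  shows "\<exists>g\<in>convex_combinations state_morphisms. \<forall>x\<in>F. \<bar>g x - s x\<bar> < e"
proof -
  define B where "B = real (card F) + 1"
  \<comment> \<open>Averaging divides the squared error \<open>n * B\<close> of the sum by the
    square of \<open>n\<close>; this \<open>n\<close> brings the quotient \<open>B / n\<close> below
    \<open>e\<^sup>2\<close>.\<close>
  obtain n :: nat where n: "B / e\<^sup>2 < real n" using reals_Archimedean2 by blast
  \<comment> \<open>\<open>B\<close> is positive even for empty \<open>F\<close>, so
    \<open>n\<close> is nonzero and the weights \<open>1 / n\<close> sum to 1.\<close>
  have "0 < B / e\<^sup>2" using e by (simp add: B_def)
  then have n0: "0 < real n" using n by linarith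
  obtain f where f: "\<And>i. i < n \<Longrightarrow> f i \<in> state_morphisms"
    "(\<Sum>x\<in>F. (\<Sum>i<n. f i x - s x)\<^sup>2) \<le> real n * B"
    using exists_state_morphism_sequence[OF s F, of n] unfolding B_def by blast
  define g where "g x = (\<Sum>i<n. (1 / real n) * f i x)" for x
  have "g \<in> convex_combinations state_morphisms"
    unfolding convex_combinations_def g_def using f(1) n0
    by (intro CollectI exI[of _ n] exI[of _ "\<lambda>_. 1 / real n"] exI[of _ f]) auto
  moreover have "\<bar>g x - s x\<bar> < e" if x: "x \<in> F" for x
  proof -
    have eq: "(\<Sum>i<n. f i x - s x) = real n * (g x - s x)"
      using n0 by (simp add: g_def sum_subtractf right_diff_distrib flip: sum_divide_distrib)
    have "(real n * (g x - s x))\<^sup>2 \<le> (\<Sum>x\<in>F. (\<Sum>i<n. f i x - s x)\<^sup>2)"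
      unfolding eq[symmetric] by (rule member_le_sum[OF x]) (auto simp: F)
    also have "\<dots> \<le> real n * B" by (rule f(2))
    also have "\<dots> < real n * (real n * e\<^sup>2)"
      using n n0 e by (simp add: divide_less_eq)
    finally have "(g x - s x)\<^sup>2 < e\<^sup>2"
      using n0 by (simp add: power_mult_distrib power2_eq_square[of "real n"] mult.assoc)
    then show ?thesis using e by (intro power2_less_imp_less[of "\<bar>g x - s x\<bar>" e]) auto
  qed
  ultimately show ?thesis by blast
qed

section \<open>Passage to the weak topology of states\<close>

theorem theorem4p12:
  "(states :: ('a::emv_algebra \<Rightarrow> real) set) =
     weak_state_topology closure_of convex_combinations state_morphisms"
proof (rule antisym)
  let ?X = "product_topology (\<lambda>_::'a. top_of_set {0..1::real}) UNIV"
  \<comment> \<open>A closure taken in a subspace stays inside that subspace.\<close>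
  show "weak_state_topology closure_of convex_combinations state_morphisms
      \<subseteq> (states :: ('a \<Rightarrow> real) set)"
    by (simp add: weak_state_topology_def closure_of_subtopology)
  have cc: "convex_combinations state_morphisms \<subseteq> (states :: ('a \<Rightarrow> real) set)"
    using convex_combinations_states state_morphisms_subset_states
    unfolding convex_combinations_def by fast
  show "(states :: ('a \<Rightarrow> real) set)
      \<subseteq> weak_state_topology closure_of convex_combinations state_morphisms"
  proof
    fix s :: "'a \<Rightarrow> real"
    assume s: "s \<in> states"
    \<comment> \<open>Since the combinations are themselves states, the closure in the subspace is
      the trace of the closure in the full cube, so neighbourhoods in the cube suffice.\<close>
    have "\<exists>g\<in>convex_combinations state_morphisms. g \<in> T" if T: "s \<in> T" "openin ?X T" for T
    proof -
      \<comment> \<open>A basic open box constrains only finitely many coordinates. There openness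
        supplies a radius; elsewhere having values in \<open>{0..1}\<close> is enough.\<close>
      obtain U where U: "finite {i. U i \<noteq> {0..1::real}}"
        "\<And>i. openin (top_of_set {0..1}) (U i)" "\<And>i. s i \<in> U i" "PiE UNIV U \<subseteq> T"
        using T unfolding openin_product_topology_alt by (force simp: PiE_iff)
      define F where "F = {i. U i \<noteq> {0..1}}"
      have "\<exists>e>0. \<forall>y\<in>{0..1}. \<bar>y - s i\<bar> < e \<longrightarrow> y \<in> U i" for i
        using U(2)[of i] U(3)[of i] unfolding openin_euclidean_subtopology_iff dist_real_def by blast
      then obtain e where e: "\<And>i. 0 < e i" "\<And>i y. y \<in> {0..1} \<Longrightarrow> \<bar>y - s i\<bar> < e i \<Longrightarrow> y \<in> U i"
        by metis
      \<comment> \<open>The inserted 1 keeps the minimum over a nonempty set when no coordinate is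
        constrained.\<close>
      define d where "d = Min (insert 1 (e ` F))"
      have F: "finite F" using U(1) by (simp add: F_def)
      then have "0 < d" using e(1) by (auto simp: d_def)
      then obtain g where g: "g \<in> convex_combinations state_morphisms"
        "\<And>x. x \<in> F \<Longrightarrow> \<bar>g x - s x\<bar> < d"
        using exists_convex_combination_approx[OF s F] by metis
      have "g i \<in> U i" for i
      proof (cases "i \<in> F")
        case True
        then have "d \<le> e i" using F by (simp add: d_def)
        then show ?thesis using e(2)[of "g i" i] g(2)[OF True] g(1) cc by (auto simp: states_def)
      next
        case False
        then show ?thesis using g(1) cc by (auto simp: F_def states_def)
      qed
      then have "g \<in> T" using U(4) by (auto simp: PiE_iff)
      then show ?thesis using g(1) by blast
    qed
    moreover have "s \<in> topspace ?X" using s by (auto simp: states_def PiE_iff)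
    ultimately have "s \<in> ?X closure_of convex_combinations state_morphisms"
      unfolding in_closure_of by blast
    then show "s \<in> weak_state_topology closure_of convex_combinations state_morphisms"
      using s cc by (simp add: weak_state_topology_def closure_of_subtopology inf_absorb2)
  qed
qed

end
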